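(* Let $q\ge 3$ and $p\ge 2$ be integers. Suppose that a connected graph $H$ with at least $3(q+p)^{2qp}$ vertices does not contain a subgraph isomorphic to $S_{q,p}$. If $\Delta(H)\ge q$, then $H$ contains neither the cycle $C_{p+1}$ nor the broken fan $B_{p+2}$ as a subgraph.
   Context: Graphs are finite and simple; "subgraph" means not necessarily induced subgraph. $\Delta(H)$ is the maximum vertex degree of $H$. The sparkler graph $S_{q,p}$ is obtained from the star $K_{1,q-1}$ and the path $P_p$ (on $p$ vertices) by adding an edge between an end vertex of $P_p$ and the central vertex of $K_{1,q-1}$. $C_{p+1}$ is the cycle on $p+1$ vertices. The broken fan $B_{p+2}$ is the graph on $p+2$ vertices $y,y',y_1,\dots,y_p$ whose edges are $y_iy_{i+1}$ for $1\le i<p$, $yy_i$ for $1\le i\le p-1$, and $yy'$ (i.e., take the fan consisting of a path $y_1\dots y_p$ plus a vertex $y$ adjacent to all $y_i$, remove the edge $yy_p$, and add a new vertex $y'$ adjacent to $y$ only). *)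

theory Defs
  imports Main
begin

record 'a graph =
  verts :: "'a set"
  edges :: "'a set set"

definition finite_simple_graph :: "'a graph \<Rightarrow> bool" where
  "finite_simple_graph G \<longleftrightarrow>
     finite (verts G) \<and> (\<forall>e\<in>edges G. e \<subseteq> verts G \<and> card e = 2)"

definition adjacent :: "'a graph \<Rightarrow> 'a \<Rightarrow> 'a \<Rightarrow> bool" where
  "adjacent G u v \<longleftrightarrow> {u, v} \<in> edges G"

definition connected_graph :: "'a graph \<Rightarrow> bool" where
  "connected_graph G \<longleftrightarrow>
     verts G \<noteq> {} \<and> (\<forall>u\<in>verts G. \<forall>v\<in>verts G. (adjacent G)\<^sup>*\<^sup>* u v)"

definition degree :: "'a graph \<Rightarrow> 'a \<Rightarrow> nat" where
  "degree G v = card {e \<in> edges G. v \<in> e}"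

text \<open>Meaningful only for graphs with a finite nonempty vertex set.\<close>
definition max_degree :: "'a graph \<Rightarrow> nat" where
  "max_degree G = Max (degree G ` verts G)"

definition subgraph :: "'a graph \<Rightarrow> 'a graph \<Rightarrow> bool" where
  "subgraph K G \<longleftrightarrow>
     finite_simple_graph K \<and> verts K \<subseteq> verts G \<and> edges K \<subseteq> edges G"

definition isomorphic :: "'a graph \<Rightarrow> 'b graph \<Rightarrow> bool" where
  "isomorphic G H \<longleftrightarrow>
     (\<exists>f. bij_betw f (verts G) (verts H) \<and>
          (\<forall>u\<in>verts G. \<forall>v\<in>verts G. adjacent G u v \<longleftrightarrow> adjacent H (f u) (f v)))"

definition contains_subgraph :: "'a graph \<Rightarrow> 'b graph \<Rightarrow> bool" where
  "contains_subgraph G F \<longleftrightarrow> (\<exists>K. subgraph K G \<and> isomorphic K F)"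

text \<open>The sparkler \<open>S\<^bsub>q,p\<^esub>\<close>, for \<open>q, p \<ge> 1\<close>: vertex \<open>0\<close> is the centre of the star
  \<open>K\<^bsub>1,q-1\<^esub>\<close>, its leaves are \<open>1, \<dots>, q - 1\<close>, and the path \<open>P\<^bsub>p\<^esub>\<close> runs through
  \<open>q, \<dots>, q + p - 1\<close>, with \<open>q\<close> the end vertex joined to the centre.\<close>
definition sparkler :: "nat \<Rightarrow> nat \<Rightarrow> nat graph" where
  "sparkler q p =
     \<lparr>verts = {0..<q + p},
      edges = {{0, i} | i. 1 \<le> i \<and> i < q}
            \<union> {{i, i + 1} | i. q \<le> i \<and> i + 1 < q + p}
            \<union> {{0, q}}\<rparr>"

text \<open>The cycle on \<open>n \<ge> 3\<close> vertices.\<close>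
definition cycle_graph :: "nat \<Rightarrow> nat graph" where
  "cycle_graph n =
     \<lparr>verts = {0..<n},
      edges = {{i, i + 1} | i. i + 1 < n} \<union> {{n - 1, 0}}\<rparr>"

text \<open>The argument is the number \<open>p\<close> of path vertices, so this is \<open>B\<^bsub>p+2\<^esub>\<close>:
  \<open>y\<close> is \<open>0\<close>, \<open>y\<^sub>i\<close> is \<open>i\<close> for \<open>1 \<le> i \<le> p\<close>, and \<open>y'\<close> is \<open>p + 1\<close>.\<close>
definition broken_fan :: "nat \<Rightarrow> nat graph" where
  "broken_fan p =
     \<lparr>verts = {0..p + 1},
      edges = {{i, i + 1} | i. 1 \<le> i \<and> i < p}
            \<union> {{0, i} | i. 1 \<le> i \<and> i \<le> p - 1}
            \<union> {{0, p + 1}}\<rparr>"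

end

theory Submission imports Defs begin

text \<open>
  If all degrees were below \<open>q + p - 1\<close>, then, \<open>H\<close> being large, a vertex of degree at least \<open>q\<close>
  would have a vertex at distance at least \<open>p\<close>; a shortest path to it avoids all other neighbours
  of its start, so it extends to a sparkler. Hence some vertex \<open>x\<close> has degree at least
  \<open>q + p - 1\<close>, and no path on \<open>p + 1\<close> vertices starts at \<open>x\<close>, since at least \<open>q - 1\<close> neighbours
  of \<open>x\<close> would lie outside such a path. But in \<open>C\<^bsub>p+1\<^esub>\<close> and in \<open>B\<^bsub>p+2\<^esub>\<close> every vertex starts a path on
  \<open>p + 1\<close> vertices, and by connectedness \<open>x\<close> would inherit one from either of them.
\<close>

section \<open>Neighbourhoods, degrees and paths from a given vertex\<close>

definition neighbours :: "'a graph \<Rightarrow> 'a \<Rightarrow> 'a set" where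
  "neighbours G v = {u. adjacent G v u}"

text \<open>Here \<open>n\<close> counts the vertices after \<open>x\<close>, so the path has
  \<open>n + 1\<close> vertices. With \<open>n = p\<close>, the list \<open>ys\<close> is a
  candidate for the path of a sparkler centred at \<open>x\<close>.\<close>

definition starts_path :: "'a graph \<Rightarrow> nat \<Rightarrow> 'a \<Rightarrow> bool" where
  "starts_path G n x \<longleftrightarrow>
     (\<exists>ys. length ys = n \<and> distinct (x # ys) \<and> successively (adjacent G) (x # ys) \<and>
           set (x # ys) \<subseteq> verts G)"

lemma adjacent_sym: "adjacent G u v \<Longrightarrow> adjacent G v u"
  by (simp add: adjacent_def insert_commute)

lemma adjacent_in_verts:
  assumes "finite_simple_graph G" "adjacent G u v"
  shows "u \<in> verts G" "v \<in> verts G"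
  using assms unfolding finite_simple_graph_def adjacent_def by blast+

lemma adjacent_neq:
  assumes "finite_simple_graph G" "adjacent G u v"
  shows "u \<noteq> v"
proof
  assume "u = v"
  then have "card {u} = 2"
    using assms unfolding finite_simple_graph_def adjacent_def by force
  then show False by simp
qed

lemma finite_neighbours: "finite_simple_graph G \<Longrightarrow> finite (neighbours G v)"
  by (rule finite_subset[of _ "verts G"])
    (auto simp: neighbours_def finite_simple_graph_def dest: adjacent_in_verts[rotated])

lemma degree_eq_card_neighbours:
  assumes "finite_simple_graph G"
  shows "degree G v = card (neighbours G v)"
proof -
  have "bij_betw (\<lambda>u. {v, u}) (neighbours G v) {e \<in> edges G. v \<in> e}"
  proof (rule bij_betwI')
    fix e assume e: "e \<in> {e \<in> edges G. v \<in> e}"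
    then have "card e = 2" using assms by (simp add: finite_simple_graph_def)
    then obtain a b where "e = {a, b}" by (meson card_2_iff)
    with e obtain u where "e = {v, u}" by auto
    with e show "\<exists>u\<in>neighbours G v. e = {v, u}"
      by (auto simp: neighbours_def adjacent_def)
  qed (auto simp: neighbours_def adjacent_def doubleton_eq_iff)
  then show ?thesis
    by (simp add: degree_def bij_betw_same_card)
qed

section \<open>Subgraph containment as injective edge-preserving maps\<close>

text \<open>The witness keeps only the images of the edges of \<open>F\<close>. It is therefore
  isomorphic to \<open>F\<close> even if \<open>G\<close> has further edges among the image
  vertices.\<close>

lemma contains_subgraphI:
  assumes F: "finite_simple_graph F"
    and inj: "inj_on f (verts F)"
    and sub: "f ` verts F \<subseteq> verts G"
    and edges: "\<And>e. e \<in> edges F \<Longrightarrow> f ` e \<in> edges G"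
  shows "contains_subgraph G F"
proof -
  define K :: "'b graph" where "K = \<lparr>verts = f ` verts F, edges = (`) f ` edges F\<rparr>"
  have e: "e \<subseteq> verts F" "card e = 2" if "e \<in> edges F" for e
    using F that by (auto simp: finite_simple_graph_def)
  have "subgraph K G"
    unfolding subgraph_def finite_simple_graph_def K_def
    using F sub edges e card_image[OF inj_on_subset[OF inj]]
    by (fastforce simp: finite_simple_graph_def)
  moreover have "isomorphic K F"
  proof -
    define g where "g = inv_into (verts F) f"
    have gf: "g (f u) = u" if "u \<in> verts F" for u
      using inj that by (simp add: g_def)
    have adj: "adjacent K (f u) (f v) \<longleftrightarrow> adjacent F u v"
      if "u \<in> verts F" "v \<in> verts F" for u v
    proof
      assume "adjacent K (f u) (f v)"
      then obtain e' where e': "e' \<in> edges F" "f ` {u, v} = f ` e'"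
        by (auto simp: adjacent_def K_def)
      \<comment> \<open>Both sets lie inside \<open>verts F\<close>, where taking images under the
        injective \<open>f\<close> is itself injective on sets.\<close>
      then have "{u, v} = e'"
        using inj_on_image_eq_iff[OF inj, of "{u, v}" e'] that e(1) by auto
      with e' show "adjacent F u v" by (simp add: adjacent_def)
    next
      assume "adjacent F u v"
      then have "f ` {u, v} \<in> edges K"
        unfolding adjacent_def K_def by (simp only: graph.simps imageI)
      then show "adjacent K (f u) (f v)" by (simp add: adjacent_def)
    qed
    have "bij_betw g (verts K) (verts F)"
      using inj by (auto simp: g_def K_def intro: bij_betw_inv_into inj_on_imp_bij_betw)
    moreover have "adjacent K u v \<longleftrightarrow> adjacent F (g u) (g v)"
      if "u \<in> verts K" "v \<in> verts K" for u v
      using that adj gf by (auto simp: K_def)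
    ultimately show ?thesis unfolding isomorphic_def by blast
  qed
  ultimately show ?thesis by (auto simp: contains_subgraph_def)
qed

text \<open>The map is the inverse of the isomorphism from the subgraph to \<open>F\<close>.
  Adjacency is transported in one direction only, since the subgraph need not be induced.\<close>

lemma contains_subgraphE:
  assumes "contains_subgraph G F"
  obtains f where "inj_on f (verts F)" "f ` verts F \<subseteq> verts G"
    "\<And>u v. u \<in> verts F \<Longrightarrow> v \<in> verts F \<Longrightarrow> adjacent F u v \<Longrightarrow> adjacent G (f u) (f v)"
proof -
  obtain K h where K: "subgraph K G" and h: "bij_betw h (verts K) (verts F)"
    and adj: "\<forall>u\<in>verts K. \<forall>v\<in>verts K. adjacent K u v \<longleftrightarrow> adjacent F (h u) (h v)"
    using assms by (auto simp: contains_subgraph_def isomorphic_def)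
  define f where "f = inv_into (verts K) h"
  have f: "bij_betw f (verts F) (verts K)"
    using h by (simp add: f_def bij_betw_inv_into)
  have hf: "h (f u) = u" "f u \<in> verts K" if "u \<in> verts F" for u
    using that h bij_betwE[OF f] by (auto simp: f_def bij_betw_inv_into_right)
  show thesis
  proof
    show "inj_on f (verts F)" using f by (rule bij_betw_imp_inj_on)
    show "f ` verts F \<subseteq> verts G"
      using f K by (auto simp: bij_betw_def subgraph_def)
    fix u v assume "u \<in> verts F" "v \<in> verts F" "adjacent F u v"
    then have "adjacent K (f u) (f v)" using adj hf by simp
    then show "adjacent G (f u) (f v)"
      using K by (auto simp: adjacent_def subgraph_def)
  qed
qed

section \<open>Building a sparkler from a path and spare neighbours\<close>

text \<open>The form \<open>Suc p\<close> makes the path nonempty, so that vertex \<open>q\<close>,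
  an end of the edge \<open>{0, q}\<close>, exists.\<close>

lemma finite_simple_graph_sparkler:
  assumes "q \<ge> 1"
  shows "finite_simple_graph (sparkler q (Suc p))"
  using assms by (auto simp: finite_simple_graph_def sparkler_def)

lemma contains_sparklerI:
  assumes G: "finite_simple_graph G" and "q \<ge> 1" and "p \<ge> 1"
    and ys: "length ys = p" "distinct (x # ys)" "successively (adjacent G) (x # ys)"
      "set (x # ys) \<subseteq> verts G"
    and many: "card (neighbours G x - set ys) \<ge> q - 1"
  shows "contains_subgraph G (sparkler q p)"
proof -
  obtain L where L: "L \<subseteq> neighbours G x - set ys" "card L = q - 1" "finite L"
    using many by (rule obtain_subset_with_card_n)
  obtain ls where ls: "set ls = L" "distinct ls"
    using finite_distinct_list[OF L(3)] by blast
  have len: "length ls = q - 1" using ls L distinct_card by metis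
  have ladj: "adjacent G x u" if "u \<in> set ls" for u
    using that L ls by (auto simp: neighbours_def)
  \<comment> \<open>The order of \<open>zs\<close> follows the numbering of the sparkler: the centre
    at position \<open>0\<close>, the leaves at \<open>1\<close> to \<open>q - 1\<close>, the path
    from \<open>q\<close> on. The embedding is then plain indexing.\<close>
  define zs where "zs = x # ls @ ys"
  define f where "f = (!) zs"
  have lenz: "length zs = q + p" using len ys \<open>q \<ge> 1\<close> by (simp add: zs_def)
  \<comment> \<open>The leaves were chosen off \<open>ys\<close>, and \<open>x\<close> is not one of
    them because \<open>G\<close> has no loops.\<close>
  have dz: "distinct zs"
    using ls ys(2) L ladj adjacent_neq[OF G] by (auto simp: zs_def)
  have sz: "set zs \<subseteq> verts G"
    using ys(4) adjacent_in_verts(2)[OF G ladj] by (auto simp: zs_def)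
  have f0: "f 0 = x" by (simp add: f_def zs_def)
  have fl: "f i \<in> set ls" if "1 \<le> i" "i < q" for i
    using that len by (auto simp: f_def zs_def nth_append nth_Cons')
  have fy: "f i = ys ! (i - q)" if "q \<le> i" for i
    using that len \<open>q \<ge> 1\<close> by (auto simp: f_def zs_def nth_append nth_Cons')
  have y0: "adjacent G x (ys ! 0)"
    using ys \<open>p \<ge> 1\<close> by (cases ys) auto
  have step: "adjacent G (ys ! i) (ys ! Suc i)" if "Suc i < p" for i
    using ys(1,3) that by (auto simp: successively_conv_nth)
  show ?thesis
  proof (rule contains_subgraphI)
    show "finite_simple_graph (sparkler q p)"
      using finite_simple_graph_sparkler[OF \<open>q \<ge> 1\<close>, of "p - 1"] \<open>p \<ge> 1\<close> by simp
    show "inj_on f (verts (sparkler q p))"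
      unfolding f_def using dz lenz by (intro inj_on_nth) (auto simp: sparkler_def)
    show "f ` verts (sparkler q p) \<subseteq> verts G"
      using sz lenz by (auto simp: sparkler_def f_def subset_iff)
    fix e assume "e \<in> edges (sparkler q p)"
    then consider i where "e = {0, i}" "1 \<le> i" "i < q"
      | i where "e = {i, i + 1}" "q \<le> i" "i + 1 < q + p"
      | "e = {0, q}"
      by (auto simp: sparkler_def)
    then show "f ` e \<in> edges G"
    proof cases
      case (1 i)
      then show ?thesis using ladj[OF fl[of i]] by (simp add: f0 adjacent_def)
    next
      case (2 i)
      then show ?thesis using step[of "i - q"]
        by (simp add: fy adjacent_def Suc_diff_le)
    next
      case 3
      then show ?thesis using y0 by (simp add: f0 fy adjacent_def)
    qed
  qed
qed

section \<open>Shortest walks, and paths inherited from a subgraph\<close>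

text \<open>Take a walk of least length from \<open>x\<close> into \<open>K\<close>. A repeated
  vertex, an earlier visit to \<open>K\<close>, or an edge from \<open>x\<close> to a vertex beyond
  the first step would each give a shorter one. The lemma is applied to a copy of a subgraph and to
  the complement of a ball.\<close>

lemma shortest_walk_to_set:
  assumes "r\<^sup>*\<^sup>* x w" "w \<in> K"
  obtains k f where "f 0 = x" "f k \<in> K" "\<And>i. i < k \<Longrightarrow> r (f i) (f (Suc i))"
    "inj_on f {..k}" "\<And>i. i < k \<Longrightarrow> f i \<notin> K"
    "\<And>i. 2 \<le> i \<Longrightarrow> i \<le> k \<Longrightarrow> \<not> r x (f i)"
proof -
  define P where "P k \<longleftrightarrow> (\<exists>w\<in>K. (r ^^ k) x w)" for k
  define k where "k = (LEAST k. P k)"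
  have "\<exists>k. P k" using assms by (auto simp: P_def rtranclp_power)
  then have Pk: "P k" unfolding k_def by (rule LeastI_ex)
  have min: "\<not> P j" if "j < k" for j
    using that unfolding k_def by (rule not_less_Least)
  from Pk obtain f where f: "f 0 = x" "f k \<in> K" "\<And>i. i < k \<Longrightarrow> r (f i) (f (Suc i))"
    unfolding P_def relpowp_fun_conv by blast
  have seg: "(r ^^ (j - i)) (f i) (f j)" if "i \<le> j" "j \<le> k" for i j
    unfolding relpowp_fun_conv using that f(3)
    by (intro exI[of _ "\<lambda>n. f (i + n)"]) auto
  \<comment> \<open>Reaching \<open>f j\<close> in \<open>i\<close> steps and then following the old
    walk to its end cannot beat the minimum, so \<open>j\<close> is at most
    \<open>i\<close>.\<close>
  have short: "k \<le> i + (k - j)" if "(r ^^ i) x (f j)" "j \<le> k" for i j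
  proof -
    have "(r ^^ (i + (k - j))) x (f k)"
      unfolding relpowp_add using that seg[of j k] by auto
    then have "P (i + (k - j))" using f(2) by (auto simp: P_def)
    then show ?thesis using min not_le by blast
  qed
  show thesis
  proof
    show "f 0 = x" "f k \<in> K" "\<And>i. i < k \<Longrightarrow> r (f i) (f (Suc i))" by (fact f)+
    show "inj_on f {..k}"
    proof (rule linorder_inj_onI')
      fix i j assume "i \<in> {..k}" "j \<in> {..k}" "i < j"
      then show "f i \<noteq> f j"
        using short[of i j] seg[of 0 i] f(1) by auto
    qed
    show "f i \<notin> K" if "i < k" for i
      using min[OF that] seg[of 0 i] that f(1) by (auto simp: P_def)
    show "\<not> r x (f i)" if "2 \<le> i" "i \<le> k" for i
      using short[of 1 i] that by (auto simp del: One_nat_def simp: relpowp_1)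
  qed
qed

lemma starts_path_mono:
  assumes "starts_path G n x" "m \<le> n"
  shows "starts_path G m x"
proof -
  obtain ys where ys: "length ys = n" "distinct (x # ys)" "successively (adjacent G) (x # ys)"
      "set (x # ys) \<subseteq> verts G"
    using assms by (auto simp: starts_path_def)
  have eq: "x # ys = (x # take m ys) @ drop m ys" by simp
  show ?thesis
    unfolding starts_path_def
  proof (intro exI[of _ "take m ys"] conjI)
    show "length (take m ys) = m" using ys assms by simp
    show "distinct (x # take m ys)" "set (x # take m ys) \<subseteq> verts G"
      using ys(2,4) by (auto dest: in_set_takeD)
    show "successively (adjacent G) (x # take m ys)"
      using ys(3) unfolding eq by (simp only: successively_append_iff)
  qed
qed

text \<open>A shortest walk from \<open>x\<close> to the copy of \<open>F\<close> meets the copy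
  only in its last vertex. There a path inside the copy can be appended without repeating vertices,
  and the result is cut down to the required length.\<close>

lemma starts_path_of_subgraph:
  assumes G: "finite_simple_graph G" "connected_graph G"
    and F: "contains_subgraph G F" "verts F \<noteq> {}"
    and start: "\<And>v. v \<in> verts F \<Longrightarrow> starts_path F n v"
    and x: "x \<in> verts G"
  shows "starts_path G n x"
proof -
  obtain f where f: "inj_on f (verts F)" "f ` verts F \<subseteq> verts G"
    "\<And>u v. u \<in> verts F \<Longrightarrow> v \<in> verts F \<Longrightarrow> adjacent F u v \<Longrightarrow> adjacent G (f u) (f v)"
    using F(1) by (rule contains_subgraphE) blast
  obtain v0 where v0: "v0 \<in> verts F" using F(2) by blast
  have "(adjacent G)\<^sup>*\<^sup>* x (f v0)"
    using G(2) x f(2) v0 by (auto simp: connected_graph_def)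
  then obtain k g where g: "g 0 = x" "g k \<in> f ` verts F"
    "\<And>i. i < k \<Longrightarrow> adjacent G (g i) (g (Suc i))" "inj_on g {..k}"
    "\<And>i. i < k \<Longrightarrow> g i \<notin> f ` verts F"
    using imageI[OF v0] by (rule shortest_walk_to_set) blast
  obtain v where v: "v \<in> verts F" "g k = f v" using g(2) by blast
  obtain ys where ys: "length ys = n" "distinct (v # ys)"
    "successively (adjacent F) (v # ys)" "set (v # ys) \<subseteq> verts F"
    using start[OF v(1)] by (auto simp: starts_path_def)
  \<comment> \<open>The walk stops before index \<open>k\<close> because its last vertex
    \<open>g k\<close> equals \<open>f v\<close>, the head of the second part. For
    \<open>k = 0\<close>, \<open>x\<close> already lies in the copy.\<close>
  define zs where "zs = map g [0..<k] @ map f (v # ys)"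
  have "distinct (map g [0..<k])"
    using g(4) by (auto simp: distinct_map intro: inj_on_subset)
  moreover have "distinct (map f (v # ys))"
    using ys(2,4) f(1) by (auto simp only: distinct_map intro: inj_on_subset)
  moreover have "set (map g [0..<k]) \<inter> f ` verts F = {}"
    unfolding set_map disjoint_iff using g(5) by (metis atLeastLessThan_iff imageE set_upt)
  moreover have "set (map f (v # ys)) \<subseteq> f ` verts F"
    using ys(4) by auto
  ultimately have dz: "distinct zs"
    unfolding zs_def distinct_append by blast
  have "successively (adjacent G) (map g [0..<k])"
    using g(3) by (simp add: successively_conv_nth)
  moreover have "successively (adjacent G) (map f (v # ys))"
    unfolding successively_map
    by (rule successively_mono[OF ys(3)]) (use f(3) ys(4) in auto)
  ultimately have sz: "successively (adjacent G) zs"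
    using g(3)[of "k - 1"] v(2) unfolding zs_def successively_append_iff
    by (cases k) auto
  have "g i \<in> verts G" if "i < k" for i
    using adjacent_in_verts[OF G(1) g(3)[OF that]] by simp
  then have vz: "set zs \<subseteq> verts G"
    using f(2) ys(4) by (auto simp: zs_def)
  have hz: "zs = x # tl zs"
    using g(1) v(2) by (cases k) (auto simp: zs_def upt_conv_Cons simp del: upt_Suc)
  have "starts_path G (length (tl zs)) x"
    unfolding starts_path_def using dz sz vz hz by metis
  moreover have "n \<le> length (tl zs)" using ys(1) by (simp add: zs_def)
  ultimately show ?thesis by (rule starts_path_mono)
qed

section \<open>Vertices of large degree\<close>

lemma no_path_from_large_degree:
  assumes G: "finite_simple_graph G" and "q \<ge> 1" "p \<ge> 1"
    and free: "\<not> contains_subgraph G (sparkler q p)"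
    and deg: "degree G x \<ge> q + p - 1"
  shows "\<not> starts_path G p x"
proof
  assume "starts_path G p x"
  then obtain ys where ys: "length ys = p" "distinct (x # ys)"
    "successively (adjacent G) (x # ys)" "set (x # ys) \<subseteq> verts G"
    by (auto simp: starts_path_def)
  \<comment> \<open>The path takes away at most \<open>p\<close> of the at least
    \<open>q + p - 1\<close> neighbours, which leaves enough for the \<open>q - 1\<close>
    leaves.\<close>
  have "card (neighbours G x) - card (set ys) \<le> card (neighbours G x - set ys)"
    by (rule diff_card_le_card_Diff) simp
  moreover have "card (set ys) = p" using ys by (simp add: distinct_card)
  ultimately have "q - 1 \<le> card (neighbours G x - set ys)"
    using deg by (simp add: degree_eq_card_neighbours[OF G])
  with free show False
    using contains_sparklerI[OF G \<open>q \<ge> 1\<close> \<open>p \<ge> 1\<close> ys] by blast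
qed

text \<open>Enlarging the radius by one covers the new ball by the closed neighbourhoods of the
  vertices of the old one. Each of these has at most \<open>Suc d\<close> elements, so the bound
  gains one factor per step.\<close>

lemma card_ball_le:
  assumes G: "finite_simple_graph G" and x: "x \<in> verts G"
    and deg: "\<And>v. v \<in> verts G \<Longrightarrow> degree G v \<le> d"
  shows "{u. \<exists>k\<le>n. (adjacent G ^^ k) x u} \<subseteq> verts G \<and>
         card {u. \<exists>k\<le>n. (adjacent G ^^ k) x u} \<le> Suc d ^ n"
proof (induction n)
  case 0
  have "{u. \<exists>k\<le>0. (adjacent G ^^ k) x u} = {x}" by auto
  then show ?case using x by simp
next
  case (Suc n)
  let ?B = "\<lambda>n. {u. \<exists>k\<le>n. (adjacent G ^^ k) x u}"
  let ?N = "\<lambda>u. insert u (neighbours G u)"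
  have fin: "finite (?B n)"
    using Suc.IH G finite_subset unfolding finite_simple_graph_def by blast
  have sub: "?B (Suc n) \<subseteq> (\<Union>u\<in>?B n. ?N u)"
  proof
    fix w assume "w \<in> ?B (Suc n)"
    then obtain k where k: "k \<le> Suc n" "(adjacent G ^^ k) x w" by blast
    show "w \<in> (\<Union>u\<in>?B n. ?N u)"
    proof (cases k)
      case 0
      then have "w \<in> ?B n" using k by (auto intro!: exI[of _ 0])
      then show ?thesis by blast
    next
      case (Suc j)
      then obtain u where "(adjacent G ^^ j) x u" "adjacent G u w"
        using k by auto
      then show ?thesis using k Suc by (auto simp: neighbours_def)
    qed
  qed
  have "card (?N u) \<le> Suc d" if "u \<in> ?B n" for u
  proof -
    have "card (?N u) \<le> Suc (card (neighbours G u))"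
      by (simp add: card_insert_le_m1)
    also have "card (neighbours G u) \<le> d"
      using deg[of u] Suc.IH that by (auto simp: degree_eq_card_neighbours[OF G])
    finally show ?thesis by simp
  qed
  then have "(\<Sum>u\<in>?B n. card (?N u)) \<le> card (?B n) * Suc d"
    using sum_bounded_above[of "?B n" "\<lambda>u. card (?N u)" "Suc d"] by simp
  moreover have "card (\<Union>u\<in>?B n. ?N u) \<le> (\<Sum>u\<in>?B n. card (?N u))"
    using fin by (rule card_UN_le)
  moreover have "card (?B (Suc n)) \<le> card (\<Union>u\<in>?B n. ?N u)"
    using sub fin finite_neighbours[OF G] by (intro card_mono) auto
  moreover have "card (?B n) * Suc d \<le> Suc d ^ Suc n"
    unfolding power_Suc2 using Suc.IH by (intro mult_right_mono) auto
  moreover have "(\<Union>u\<in>?B n. ?N u) \<subseteq> verts G"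
    using Suc.IH adjacent_in_verts[OF G] by (auto simp: neighbours_def)
  ultimately show ?case using sub by (meson order_trans)
qed

lemma exists_large_degree:
  assumes G: "finite_simple_graph G" "connected_graph G" and "q \<ge> 1" "p \<ge> 1"
    and free: "\<not> contains_subgraph G (sparkler q p)"
    and v: "v \<in> verts G" "degree G v \<ge> q"
    and large: "card (verts G) > Suc d ^ p"
  shows "\<exists>x\<in>verts G. degree G x > d"
proof (rule ccontr)
  assume "\<not> ?thesis"
  then have deg: "degree G x \<le> d" if "x \<in> verts G" for x
    using that by (auto simp: not_less)
  \<comment> \<open>The radius is \<open>p - 1\<close> so that a vertex outside \<open>B\<close> has
    distance at least \<open>p\<close>, which supplies the \<open>p\<close> path vertices after
    \<open>v\<close>.\<close>
  define B where "B = {u. \<exists>k\<le>p - 1. (adjacent G ^^ k) v u}"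
  have B: "B \<subseteq> verts G" "card B \<le> Suc d ^ (p - 1)"
    using card_ball_le[OF G(1) v(1) deg, of "p - 1"] by (auto simp: B_def)
  have "Suc d ^ (p - 1) \<le> Suc d ^ p" by (rule power_increasing) auto
  with B large have "card B < card (verts G)" by linarith
  with B obtain w where w: "w \<in> verts G" "w \<in> - B" by (metis ComplI less_irrefl subsetI subset_antisym)
  have "(adjacent G)\<^sup>*\<^sup>* v w"
    using G(2) v w by (auto simp: connected_graph_def)
  then obtain k f where f: "f 0 = v" "f k \<in> - B"
    "\<And>i. i < k \<Longrightarrow> adjacent G (f i) (f (Suc i))" "inj_on f {..k}"
    "\<And>i. 2 \<le> i \<Longrightarrow> i \<le> k \<Longrightarrow> \<not> adjacent G v (f i)"
    using w(2) by (rule shortest_walk_to_set) blast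
  have "(adjacent G ^^ k) v (f k)"
    unfolding relpowp_fun_conv using f by blast
  then have "\<not> k \<le> p - 1" using f(2) unfolding B_def by blast
  then have "p \<le> k" by simp
  define ys where "ys = map f [1..<Suc p]"
  have vys: "v # ys = map f [0..<Suc p]"
    using f(1) by (simp add: ys_def upt_conv_Cons del: upt_Suc)
  have "distinct (v # ys)"
    unfolding vys using f(4) \<open>p \<le> k\<close>
    by (auto simp: distinct_map simp del: upt_Suc intro: inj_on_subset)
  moreover have "successively (adjacent G) (v # ys)"
    unfolding vys using f(3) \<open>p \<le> k\<close>
    by (simp add: successively_conv_nth del: upt_Suc)
  moreover have "set (v # ys) \<subseteq> verts G"
  proof -
    have "f i \<in> verts G" if "i \<le> p" for i
      using that v(1) f(1) adjacent_in_verts(2)[OF G(1) f(3)[of "i - 1"]] \<open>p \<le> k\<close>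
      by (cases i) auto
    then show ?thesis unfolding vys by (auto simp del: upt_Suc)
  qed
  moreover have "q - 1 \<le> card (neighbours G v - set ys)"
  proof -
    \<comment> \<open>On a shortest walk only the first vertex after \<open>v\<close> is adjacent to
      \<open>v\<close>. So the path uses up a single neighbour, and degree \<open>q\<close> leaves
      \<open>q - 1\<close> leaves.\<close>
    have "neighbours G v \<inter> set ys \<subseteq> {f 1}"
    proof
      fix u assume "u \<in> neighbours G v \<inter> set ys"
      then obtain i where i: "1 \<le> i" "i \<le> p" "u = f i" "adjacent G v (f i)"
        by (auto simp: ys_def neighbours_def simp del: upt_Suc)
      then have "i = 1" using f(5)[of i] \<open>p \<le> k\<close> by force
      with i show "u \<in> {f 1}" by simp
    qed
    then have "neighbours G v - {f 1} \<subseteq> neighbours G v - set ys" by auto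
    then have "card (neighbours G v - {f 1}) \<le> card (neighbours G v - set ys)"
      using finite_neighbours[OF G(1)] by (intro card_mono) auto
    moreover have "card (neighbours G v) - 1 \<le> card (neighbours G v - {f 1})"
      using diff_card_le_card_Diff[of "{f 1}" "neighbours G v"] by simp
    ultimately show ?thesis
      using v(2) by (simp add: degree_eq_card_neighbours[OF G(1)])
  qed
  ultimately have "contains_subgraph G (sparkler q p)"
    using contains_sparklerI[OF G(1) \<open>q \<ge> 1\<close> \<open>p \<ge> 1\<close>, of ys v] by (simp add: ys_def)
  with free show False by blast
qed

section \<open>Long paths in the cycle and the broken fan\<close>

lemma successively_upt:
  "(\<And>i. a \<le> i \<Longrightarrow> Suc i < b \<Longrightarrow> P i (Suc i)) \<Longrightarrow> successively P [a..<b]"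
  by (simp add: successively_conv_nth)

lemma successively_rev_upt:
  "(\<And>i. a \<le> i \<Longrightarrow> Suc i < b \<Longrightarrow> P (Suc i) i) \<Longrightarrow> successively P (rev [a..<b])"
  unfolding successively_rev by (rule successively_upt)

text \<open>Go once around: from \<open>v\<close> up to \<open>p\<close>, over the closing edge to
  \<open>0\<close>, then up to \<open>v - 1\<close>. For \<open>v = 0\<close> the closing edge does
  not occur.\<close>

lemma starts_path_cycle_graph:
  assumes "v \<in> verts (cycle_graph (Suc p))"
  shows "starts_path (cycle_graph (Suc p)) p v"
proof -
  let ?C = "cycle_graph (Suc p)"
  have v: "v \<le> p" using assms by (simp add: cycle_graph_def)
  have step: "adjacent ?C i (Suc i)" if "Suc i < Suc p" for i
    using that by (auto simp: adjacent_def cycle_graph_def)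
  have closing: "adjacent ?C p 0"
    by (auto simp: adjacent_def cycle_graph_def)
  let ?ys = "[Suc v..<Suc p] @ [0..<v]"
  have eq: "v # ?ys = [v..<Suc p] @ [0..<v]"
    using v by (simp add: upt_conv_Cons del: upt_Suc)
  have "length ?ys = p" using v by simp
  moreover have "distinct (v # ?ys)" "set (v # ?ys) \<subseteq> verts ?C"
    unfolding eq using v by (auto simp: cycle_graph_def simp del: upt_Suc)
  moreover have "successively (adjacent ?C) (v # ?ys)"
    unfolding eq successively_append_iff using v step closing
    by (cases "v = 0") (auto intro!: successively_upt simp del: upt_Suc simp: last_upt hd_upt)
  ultimately show ?thesis unfolding starts_path_def by blast
qed

text \<open>Each route visits all but one of the \<open>p + 2\<close> vertices. The omitted one is
  the last path vertex \<open>p\<close> when the start is \<open>p - 1\<close> or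
  \<open>p + 1\<close>, and the pendant vertex \<open>p + 1\<close> otherwise.\<close>

lemma starts_path_broken_fan:
  assumes p: "p \<ge> 2" and v: "v \<in> verts (broken_fan p)"
  shows "starts_path (broken_fan p) p v"
proof -
  let ?B = "broken_fan p"
  have step: "adjacent ?B i (Suc i)" if "1 \<le> i" "i < p" for i
    using that by (auto simp: adjacent_def broken_fan_def)
  have spoke: "adjacent ?B 0 i" if "1 \<le> i" "i < p" for i
    using that by (auto simp: adjacent_def broken_fan_def)
  have pendant: "adjacent ?B 0 (Suc p)"
    by (auto simp: adjacent_def broken_fan_def)
  have up: "successively (adjacent ?B) [a..<b]" if "1 \<le> a" "b \<le> Suc p" for a b
    using that step by (intro successively_upt) auto
  have down: "successively (adjacent ?B) (rev [1..<b])" if "b \<le> Suc p" for b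
    using that step by (intro successively_rev_upt adjacent_sym[OF step]) auto
  have consec: "v # rev [1..<v] @ xs = rev [1..<Suc v] @ xs" if "1 \<le> v" for v :: nat and xs
    using that by simp
  \<comment> \<open>From a path vertex the route descends to \<open>1\<close> and crosses to the
    centre \<open>0\<close>. It would then resume at \<open>v + 1\<close>, but for
    \<open>v = p - 1\<close> this needs the missing spoke to \<open>p\<close>, and for
    \<open>v = p\<close> nothing remains; hence the separate cases.\<close>
  consider "v = 0" | "v = Suc p" | "v = p" | "v = p - 1" | "1 \<le> v" "v < p - 1"
    using v by (auto simp: broken_fan_def) linarith
  then show ?thesis
  proof cases
    case 1
    have "successively (adjacent ?B) ([0] @ [1..<Suc p])"
      unfolding successively_append_iff using up spoke[of 1] p by (simp del: upt_Suc)
    then show ?thesis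
      unfolding starts_path_def 1
      by (intro exI[of _ "[1..<Suc p]"]) (auto simp: broken_fan_def simp del: upt_Suc)
  next
    case 2
    have "successively (adjacent ?B) ([Suc p, 0] @ [1..<p])"
      unfolding successively_append_iff
      using up spoke[of 1] adjacent_sym[OF pendant] p by (simp del: upt_Suc)
    then show ?thesis
      unfolding starts_path_def 2 using p
      by (intro exI[of _ "0 # [1..<p]"]) (auto simp: broken_fan_def simp del: upt_Suc)
  next
    case 3
    have "successively (adjacent ?B) (rev [1..<Suc p] @ [0])"
      unfolding successively_append_iff
      using down adjacent_sym[OF spoke[of 1]] p by (simp add: last_rev del: upt_Suc)
    then have "successively (adjacent ?B) (p # rev [1..<p] @ [0])"
      using p by (simp only: consec)
    then show ?thesis
      unfolding starts_path_def 3 using p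
      by (intro exI[of _ "rev [1..<p] @ [0]"]) (auto simp: broken_fan_def simp del: upt_Suc)
  next
    case 4
    then have v: "1 \<le> v" "Suc v = p" using p by auto
    \<comment> \<open>The pendant edge replaces the missing spoke and gives the route its last
      vertex.\<close>
    have "successively (adjacent ?B) (rev [1..<Suc v] @ [0, Suc p])"
      unfolding successively_append_iff
      using down adjacent_sym[OF spoke[of 1]] pendant v by (simp add: last_rev del: upt_Suc)
    then have "successively (adjacent ?B) (v # rev [1..<v] @ [0, Suc p])"
      by (simp only: consec[OF v(1)])
    then show ?thesis
      unfolding starts_path_def using v
      by (intro exI[of _ "rev [1..<v] @ [0, Suc p]"]) (auto simp: broken_fan_def simp del: upt_Suc)
  next
    case 5
    have "successively (adjacent ?B) (rev [1..<Suc v] @ [0] @ [Suc v..<Suc p])"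
      unfolding successively_append_iff
      using down up adjacent_sym[OF spoke[of 1]] spoke[of "Suc v"] 5
      by (simp add: last_rev del: upt_Suc)
    then have "successively (adjacent ?B) (v # rev [1..<v] @ [0] @ [Suc v..<Suc p])"
      by (simp only: consec[OF 5(1)])
    then show ?thesis
      unfolding starts_path_def using 5
      by (intro exI[of _ "rev [1..<v] @ [0] @ [Suc v..<Suc p]"])
        (auto simp: broken_fan_def simp del: upt_Suc)
  qed
qed

theorem lemma7:
  fixes H :: "'a graph" and q p :: nat
  assumes "q \<ge> 3" and "p \<ge> 2"
    and "finite_simple_graph H"
    and "connected_graph H"
    and "card (verts H) \<ge> 3 * (q + p) ^ (2 * q * p)"
    and "\<not> contains_subgraph H (sparkler q p)"
    and "max_degree H \<ge> q"
  shows "\<not> contains_subgraph H (cycle_graph (p + 1)) \<and>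
         \<not> contains_subgraph H (broken_fan p)"
proof -
  have fin: "finite (verts H)" and ne: "verts H \<noteq> {}"
    using assms(3,4) by (auto simp: finite_simple_graph_def connected_graph_def)
  then have "max_degree H \<in> degree H ` verts H"
    unfolding max_degree_def by (intro Max_in) auto
  then obtain v where v: "v \<in> verts H" "degree H v \<ge> q" using assms(7) by auto
  \<comment> \<open>The degree bound is applied with \<open>d = q + p - 2\<close>, since exceeding
    it means degree at least \<open>q + p - 1\<close>, as the exclusion of long paths from
    \<open>x\<close> requires.\<close>
  have "Suc (q + p - 2) ^ p \<le> (q + p) ^ p"
    using assms(1) by (intro power_mono) auto
  also have "\<dots> \<le> (q + p) ^ (2 * q * p)"
    using assms(1) by (intro power_increasing) auto
  also have "\<dots> < 3 * (q + p) ^ (2 * q * p)"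
    using assms(1) by simp
  also note assms(5)
  finally obtain x where x: "x \<in> verts H" "degree H x > q + p - 2"
    using exists_large_degree[OF assms(3,4) _ _ assms(6) v] assms(1,2) by auto
  have "\<not> starts_path H p x"
    using no_path_from_large_degree[OF assms(3) _ _ assms(6)] x(2) assms(1,2) by simp
  moreover have "starts_path H p x" if "contains_subgraph H (cycle_graph (p + 1))"
    using starts_path_of_subgraph[OF assms(3,4) that] starts_path_cycle_graph x(1)
    by (simp add: cycle_graph_def)
  moreover have "starts_path H p x" if "contains_subgraph H (broken_fan p)"
    using starts_path_of_subgraph[OF assms(3,4) that _ starts_path_broken_fan[OF assms(2)] x(1)]
    by (simp add: broken_fan_def)
  ultimately show ?thesis by blast
qed

end
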